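(* Let $\mathfrak{q}\in\mathbb{R}$ and let $s(\mathfrak{w})=\sqrt{1+\mathfrak{q}^2-\mathfrak{w}^2}$ denote the principal branch ($\operatorname{Re}s>0$), for $\mathfrak{w}$ in $\mathbb{C}$ minus the cuts $\{\mathfrak{w}\in\mathbb{R}:\mathfrak{w}^2\ge 1+\mathfrak{q}^2\}$. (i) (Physical sheet.) The dilaton quasinormal-mode condition $$\frac{1+s(\mathfrak{w})-i\mathfrak{w}}{2}=-n,\qquad n\in\{0,1,2,\dots\},$$ has no solution $\mathfrak{w}$. (ii) (Second sheet.) The set of solutions of the condition obtained by flipping the sign of the square root, $$\frac{1-s(\mathfrak{w})-i\mathfrak{w}}{2}=-n,\qquad n\in\{0,1,2,\dots\},$$ consists, for each $n$, of exactly the single value $$\mathfrak{w}_n=-2i\,\frac{n(n+1)}{2n+1}+i\,\frac{\mathfrak{q}^2}{2(2n+1)}.$$ (iii) When $\mathfrak{q}=0$ the $n=0$ solution $\mathfrak{w}_0=0$ is not a genuine quasinormal mode: the connection coefficient $C_{00}(\mathfrak{w})=\dfrac{\Gamma(1-i\mathfrak{w})\,\Gamma(-s(\mathfrak{w}))}{\Gamma\left(\frac{1-s(\mathfrak{w})-i\mathfrak{w}}{2}\right)^2}$ tends to a nonzero limit as $\mathfrak{w}\to0$; and $\operatorname{Im}\mathfrak{w}_n<0$ for all $n\ge1$. When $\mathfrak{q}\neq0$, $\mathfrak{w}_0=i\mathfrak{q}^2/2$ lies in the upper half plane, and more of the $\mathfrak{w}_n$ move to the upper half plane as $|\mathfrak{q}|$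 increases.
   Context: The conditions arise from the dilaton fluctuation equation $Z''-\frac{1}{1-u}Z'+\frac{\mathfrak{w}^2-(1-u)\mathfrak{q}^2}{4u^2(1-u)^2}Z=0$ on $0<u<1$ ($u=0$: spatial infinity, $u=1$: horizon), which becomes a hypergeometric equation $u(1-u)y''+(c-(a+b+1)u)y'-ab\,y=0$ via $Z=u^{c/2}(1-u)^{-i\mathfrak{w}/2}y$ with $c=1+s$, $a=b=\frac{1+s-i\mathfrak{w}}{2}$. The solution infalling at the horizon is $y_1={}_2F_1(a,b;1-c+a+b;1-u)=C_{00}\,{}_2F_1(a,b;c;u)+C_{01}\,u^{1-c}{}_2F_1(a+1-c,b+1-c;2-c;u)$, with $C_{00}=\frac{\Gamma(1-c+a+b)\Gamma(1-c)}{\Gamma(1-c+a)\Gamma(1-c+b)}$ and $C_{01}=\frac{\Gamma(1-c+a+b)\Gamma(c-1)}{\Gamma(a)\Gamma(b)}$. The physical-sheet condition is $a=-n$ (from $C_{01}=0$), and the second-sheet condition is $1-c+a=-n$ (from $C_{00}=0$). *)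

theory Defs
  imports "HOL-Complex_Analysis.Complex_Analysis"
begin

text \<open>
  The parameter \<open>q\<close> is the (dimensionless) wave number and \<open>w\<close> the complex frequency.
  The hypergeometric parameters of the dilaton equation are \<open>c = 1 + s\<close> and
  \<open>a = b = (1 + s - \<i> w) / 2\<close>.
\<close>

definition cut_plane :: "real \<Rightarrow> complex set" where
  "cut_plane q = - {w. w \<in> \<real> \<and> (Re w)\<^sup>2 \<ge> 1 + q\<^sup>2}"

definition disp_root :: "real \<Rightarrow> complex \<Rightarrow> complex" where
  "disp_root q w = csqrt (1 + (of_real q)\<^sup>2 - w\<^sup>2)"

lemma disp_root_square: "(disp_root q w)\<^sup>2 = 1 + (of_real q)\<^sup>2 - w\<^sup>2"
  by (simp add: disp_root_def)

lemma Re_disp_root_pos: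
  assumes "w \<in> cut_plane q"
  shows "Re (disp_root q w) > 0"
proof (rule ccontr)
  assume "\<not> Re (disp_root q w) > 0"
  moreover have "Re (disp_root q w) \<ge> 0"
    using csqrt_principal[of "1 + (of_real q)\<^sup>2 - w\<^sup>2"] by (auto simp: disp_root_def)
  ultimately have r0: "Re (disp_root q w) = 0" by simp
  have sq: "(disp_root q w)\<^sup>2 = 1 + (of_real q)\<^sup>2 - w\<^sup>2" by (rule disp_root_square)
  have im: "Re w * Im w = 0"
    using arg_cong[OF sq, of Im] r0 by (auto simp: power2_eq_square)
  have re: "(Re w)\<^sup>2 = 1 + q\<^sup>2 + (Im w)\<^sup>2 + (Im (disp_root q w))\<^sup>2"
    using arg_cong[OF sq, of Re] r0 by (simp add: power2_eq_square)
  have "1 + q\<^sup>2 + (Im w)\<^sup>2 + (Im (disp_root q w))\<^sup>2 > 0"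
    by (intro add_pos_nonneg) auto
  with re have "Re w \<noteq> 0" by auto
  with im have "Im w = 0" by simp
  with re assms show False by (auto simp: cut_plane_def complex_is_Real_iff)
qed

text \<open>
  Physical sheet: \<open>a = -n\<close>, a pole of \<open>\<Gamma>(a) \<Gamma>(b)\<close> in the denominator of \<open>C\<^sub>0\<^sub>1\<close>.
  Second sheet: \<open>1 - c + a = -n\<close>, a pole of the denominator of \<open>C\<^sub>0\<^sub>0\<close>;
  that need not be a zero of \<open>C\<^sub>0\<^sub>0\<close>, because its numerator may have a pole there too.
\<close>

definition physical_sheet_condition :: "real \<Rightarrow> nat \<Rightarrow> complex \<Rightarrow> bool" where
  "physical_sheet_condition q n w \<longleftrightarrow> (1 + disp_root q w - \<i> * w) / 2 = - of_nat n"

definition second_sheet_condition :: "real \<Rightarrow> nat \<Rightarrow> complex \<Rightarrow> bool" where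
  "second_sheet_condition q n w \<longleftrightarrow> (1 - disp_root q w - \<i> * w) / 2 = - of_nat n"

definition mode_freq :: "real \<Rightarrow> nat \<Rightarrow> complex" where
  "mode_freq q n =
     - 2 * \<i> * (of_nat n * (of_nat n + 1) / (2 * of_nat n + 1))
     + \<i> * ((of_real q)\<^sup>2 / (2 * (2 * of_nat n + 1)))"

text \<open>
  The coefficient \<open>C\<^sub>0\<^sub>0 = \<Gamma>(1-c+a+b) \<Gamma>(1-c) / (\<Gamma>(1-c+a) \<Gamma>(1-c+b))\<close> at the above parameters.
  The library's \<open>Gamma\<close> is 0 at its poles, so only limits of this function, not its values,
  are meaningful at points where a factor has a pole.
\<close>

definition conn_coeff_C00 :: "real \<Rightarrow> complex \<Rightarrow> complex" where
  "conn_coeff_C00 q w =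
     Gamma (1 - \<i> * w) * Gamma (- disp_root q w)
       / (Gamma ((1 - disp_root q w - \<i> * w) / 2))\<^sup>2"

definition upper_modes :: "real \<Rightarrow> nat set" where
  "upper_modes q = {n. Im (mode_freq q n) > 0}"

end

theory Submission
  imports Defs
begin

text \<open>
  With \<open>N = 2n + 1\<close>, either sheet's condition reads \<open>s = \<plusminus>(N - \<i> w)\<close>. Squaring and using
  \<open>s\<^sup>2 + w\<^sup>2 = 1 + q\<^sup>2\<close> cancels the quadratic term, so that \<open>w\<close> is the same unique value on both
  sheets, and then \<open>s = \<plusminus>(N\<^sup>2 + 1 + q\<^sup>2) / (2N)\<close>, whose sign decides which sheet carries the solution.

  At \<open>q = 0\<close>, \<open>w = 0\<close> the double zero of \<open>1 / \<Gamma>((1 - s - \<i> w)/2)\<^sup>2\<close> meets the pole of \<open>\<Gamma>(-s)\<close>, which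
  is also of second order in \<open>w\<close> because \<open>1 - s = w\<^sup>2 / (1 + s)\<close>.
\<close>

text \<open>Since \<open>4n(n + 1) = N^2 - 1\<close> for \<open>N = 2n + 1\<close>, both terms merge
  into the shape that solving for \<open>w\<close> produces, visibly purely imaginary.\<close>

lemma mode_freq_eq:
  "mode_freq q n = \<i> * of_real ((1 + q\<^sup>2 - (2 * real n + 1)\<^sup>2) / (2 * (2 * real n + 1)))"
proof -
  define N where "N = 2 * complex_of_nat n + 1"
  have N: "N = of_nat (2 * n + 1)" and n: "of_nat n = (N - 1) / 2"
    by (simp_all add: N_def)
  have "N \<noteq> 0"
    unfolding N of_nat_eq_0_iff by simp
  hence "mode_freq q n = \<i> * ((1 + (of_real q)\<^sup>2 - N\<^sup>2) / (2 * N))"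
    unfolding mode_freq_def N_def[symmetric] unfolding n
    by (simp add: field_simps power2_eq_square)
  thus ?thesis
    by (simp add: N_def)
qed

lemma Im_mode_freq:
  "Im (mode_freq q n) = (1 + q\<^sup>2 - (2 * real n + 1)\<^sup>2) / (2 * (2 * real n + 1))"
  by (simp only: mode_freq_eq) simp

lemma sheet_condition_solution:
  fixes N :: real
  assumes "N \<noteq> 0"
    and "disp_root q w = of_real N - \<i> * w \<or> disp_root q w = \<i> * w - of_real N"
  shows "w = \<i> * of_real ((1 + q\<^sup>2 - N\<^sup>2) / (2 * N))"
proof -
  \<comment> \<open>Both disjuncts have the same square, so the sheet is forgotten here.\<close>
  have "(of_real N - \<i> * w)\<^sup>2 = of_real (1 + q\<^sup>2) - w\<^sup>2"
    using assms(2) disp_root_square[of q w] by (auto simp: power2_commute)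
  hence "2 * of_real N * w = \<i> * (of_real (1 + q\<^sup>2) - (of_real N)\<^sup>2)"
    by (simp add: power2_diff power_mult_distrib) (simp add: complex_eq_iff algebra_simps)
  with assms(1) show ?thesis
    by (simp add: field_simps)
qed

lemma no_physical_sheet_mode:
  assumes "w \<in> cut_plane q"
  shows "\<not> physical_sheet_condition q n w"
proof
  define N where "N = 2 * real n + 1"
  have N: "N > 0" by (simp add: N_def)
  assume "physical_sheet_condition q n w"
  hence s: "disp_root q w = \<i> * w - of_real N"
    by (simp add: physical_sheet_condition_def N_def field_simps)
  hence w: "w = \<i> * of_real ((1 + q\<^sup>2 - N\<^sup>2) / (2 * N))"
    using sheet_condition_solution[of N q w] N by simp
  have "Re (disp_root q w) = - ((1 + q\<^sup>2 - N\<^sup>2) / (2 * N)) - N"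
    unfolding s by (subst w) (simp add: minus_divide_left)
  also have "\<dots> = - ((1 + q\<^sup>2 + N\<^sup>2) / (2 * N))"
    using N by (simp add: field_simps power2_eq_square)
  also have "\<dots> < 0"
    using N by (simp add: add_pos_nonneg)
  finally show False
    using Re_disp_root_pos[OF assms] by simp
qed

text \<open>The modes are purely imaginary, while every point of the cuts has nonzero real
  part.\<close>

lemma mode_freq_in_cut_plane: "mode_freq q n \<in> cut_plane q"
proof -
  have "Re (mode_freq q n) = 0"
    by (simp only: mode_freq_eq) simp
  moreover have "\<not> 1 + q\<^sup>2 \<le> 0"
    using zero_le_power2[of q] by linarith
  ultimately show ?thesis
    by (simp add: cut_plane_def)
qed

text \<open>The radicand is the square of a positive real, whose principal root is that real
  itself.\<close>

lemma disp_root_mode_freq: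
  "disp_root q (mode_freq q n) =
     of_real ((1 + q\<^sup>2 + (2 * real n + 1)\<^sup>2) / (2 * (2 * real n + 1)))"
proof -
  define N where "N = 2 * real n + 1"
  define r where "r = (1 + q\<^sup>2 + N\<^sup>2) / (2 * N)"
  have N: "N > 0" by (simp add: N_def)
  have r: "r > 0" unfolding r_def using N by (simp add: add_pos_nonneg)
  define x where "x = (1 + q\<^sup>2 - N\<^sup>2) / (2 * N)"
  \<comment> \<open>With \<open>A = 1 + q^2\<close>, this is
    \<open>(A + N^2)^2 - (A - N^2)^2 = 4 A N^2\<close> divided by \<open>4 N^2\<close>.\<close>
  have "1 + q\<^sup>2 + x\<^sup>2 = r\<^sup>2"
    using N by (simp add: x_def r_def field_simps power2_eq_square)
  moreover have "1 + (of_real q)\<^sup>2 - (mode_freq q n)\<^sup>2 = complex_of_real (1 + q\<^sup>2 + x\<^sup>2)"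
    unfolding mode_freq_eq N_def[symmetric] x_def[symmetric] by (simp add: power_mult_distrib)
  ultimately have "1 + (of_real q)\<^sup>2 - (mode_freq q n)\<^sup>2 = (complex_of_real r)\<^sup>2"
    by simp
  thus ?thesis
    unfolding disp_root_def using r by (simp add: csqrt_square r_def N_def)
qed

lemma second_sheet_modes:
  "{w \<in> cut_plane q. second_sheet_condition q n w} = {mode_freq q n}"
proof (intro equalityI subsetI)
  define N where "N = 2 * real n + 1"
  have N: "N > 0" by (simp add: N_def)
  {
    fix w assume "w \<in> {w \<in> cut_plane q. second_sheet_condition q n w}"
    hence "disp_root q w = of_real N - \<i> * w"
      by (simp add: second_sheet_condition_def N_def field_simps)
    hence "w = \<i> * of_real ((1 + q\<^sup>2 - N\<^sup>2) / (2 * N))"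
      using sheet_condition_solution[of N q w] N by simp
    thus "w \<in> {mode_freq q n}"
      by (simp only: mode_freq_eq N_def) simp
  next
    fix w assume "w \<in> {mode_freq q n}"
    hence w: "w = mode_freq q n" by simp
    have "1 - (1 + q\<^sup>2 + N\<^sup>2) / (2 * N) + (1 + q\<^sup>2 - N\<^sup>2) / (2 * N) = 1 - N"
      using N by (simp add: field_simps power2_eq_square)
    moreover have "1 - disp_root q w - \<i> * w =
        of_real (1 - (1 + q\<^sup>2 + N\<^sup>2) / (2 * N) + (1 + q\<^sup>2 - N\<^sup>2) / (2 * N))"
      unfolding w disp_root_mode_freq unfolding mode_freq_eq N_def[symmetric] by (simp add: minus_divide_left)
    ultimately have "1 - disp_root q w - \<i> * w = of_real (1 - N)"
      by presburger
    hence "second_sheet_condition q n w"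
      by (simp add: second_sheet_condition_def N_def)
    thus "w \<in> {w \<in> cut_plane q. second_sheet_condition q n w}"
      using mode_freq_in_cut_plane w by simp
  }
qed

lemma conn_coeff_C00_tendsto: "conn_coeff_C00 0 \<midarrow>0\<rightarrow> 1 / 2"
proof -
  define s where "s = disp_root 0"
  define d where "d w = (1 - s w - \<i> * w) / 2" for w
  \<comment> \<open>\<open>H\<close> is the coefficient with the common factor \<open>w^2\<close>
    cancelled, hence continuous at 0.\<close>
  define H where "H w = Gamma (1 - \<i> * w) * ((1 + s w) * (w / (1 + s w) - \<i>)\<^sup>2 / 4)
      * (rGamma (d w + 1))\<^sup>2 / (- s w * rGamma (2 - s w))" for w
  have sq: "(s w)\<^sup>2 = 1 - w\<^sup>2" for w
    by (simp add: s_def disp_root_square)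
  have s1: "1 + s w \<noteq> 0" for w
  proof -
    have "Re (s w) \<ge> 0"
      using csqrt_principal[of "1 - w\<^sup>2"] by (auto simp: s_def disp_root_def)
    thus ?thesis by (auto simp: complex_eq_iff)
  qed
  \<comment> \<open>At \<open>w = 0\<close> itself the coefficient has the default value 0, unlike
    \<open>H\<close>.\<close>
  have eq: "conn_coeff_C00 0 w = H w" if "w \<noteq> 0" for w
  proof -
    have os: "1 - s w = w\<^sup>2 / (1 + s w)"
      using sq[of w] s1[of w] by (simp add: field_simps power2_eq_square)
    have "d w = (w\<^sup>2 / (1 + s w) - \<i> * w) / 2"
      by (simp add: d_def os)
    hence dw: "d w = w * (w / (1 + s w) - \<i>) / 2"
      by (simp add: power2_eq_square algebra_simps)
    \<comment> \<open>Two steps of the recurrence move the argument from -1 to 1 at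
      \<open>w = 0\<close> and extract the vanishing factor \<open>1 - s w\<close>.\<close>
    have "rGamma (- s w) = - s w * rGamma (1 - s w)"
      using rGamma_plus1[of "- s w"] by simp
    also have "rGamma (1 - s w) = w\<^sup>2 / (1 + s w) * rGamma (2 - s w)"
      using rGamma_plus1[of "1 - s w"] by (simp flip: os add: algebra_simps)
    finally have num: "rGamma (- s w) = - s w * (w\<^sup>2 / (1 + s w) * rGamma (2 - s w))" .
    have den: "rGamma (d w) = w * (w / (1 + s w) - \<i>) / 2 * rGamma (d w + 1)"
      using rGamma_plus1[of "d w"] dw by metis
    have "conn_coeff_C00 0 w = Gamma (1 - \<i> * w) * (rGamma (d w))\<^sup>2 / rGamma (- s w)"
      by (simp add: conn_coeff_C00_def Gamma_def d_def s_def field_simps)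
    also have "\<dots> = H w"
      unfolding num den H_def using that s1[of w]
      by (simp add: power_mult_distrib power_divide)
    finally show ?thesis .
  qed
  have s0: "s 0 = 1" by (simp add: s_def disp_root_def)
  have cs: "isCont s 0"
    unfolding s_def disp_root_def
    by (intro isCont_csqrt' continuous_intros) (simp add: complex_nonpos_Reals_iff)
  have cd: "isCont d 0"
    unfolding d_def by (intro continuous_intros cs) auto
  have "isCont H 0"
    unfolding H_def by (intro continuous_intros cs cd) (auto simp: s0 s1)
  hence "H \<midarrow>0\<rightarrow> H 0" by (simp add: isCont_def)
  moreover have "H 0 = 1 / 2"
    by (simp add: H_def s0 d_def)
  ultimately have "H \<midarrow>0\<rightarrow> 1 / 2" by simp
  thus ?thesis
    by (rule Lim_transform_eventually) (simp add: eq eventually_at_filter)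
qed

lemma Im_mode_freq_strict_mono:
  assumes "\<bar>q\<bar> < \<bar>q'\<bar>"
  shows "Im (mode_freq q n) < Im (mode_freq q' n)"
proof -
  have "q\<^sup>2 < q'\<^sup>2"
    using assms by (metis abs_ge_zero power2_abs power_strict_mono zero_less_numeral)
  thus ?thesis
    by (simp add: Im_mode_freq divide_strict_right_mono)
qed

text \<open>The numerator of \<open>Im_mode_freq\<close> equals \<open>q^2 - 4n(n + 1)\<close> and
  its denominator is positive.\<close>

lemma upper_modes_eq: "upper_modes q = {n. 4 * real n * (real n + 1) < q\<^sup>2}"
  by (auto simp: upper_modes_def Im_mode_freq zero_less_divide_iff power2_eq_square algebra_simps)

lemma upper_modes_mono:
  assumes "\<bar>q\<bar> \<le> \<bar>q'\<bar>"
  shows "upper_modes q \<subseteq> upper_modes q'"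
  using assms by (auto simp: upper_modes_eq abs_le_square_iff)

text \<open>Makes counting by \<open>card\<close> meaningful, as infinite sets have
  \<open>card\<close> 0.\<close>

lemma finite_upper_modes: "finite (upper_modes q)"
proof (rule finite_subset)
  show "upper_modes q \<subseteq> {n. real n \<le> q\<^sup>2}"
  proof
    fix n assume "n \<in> upper_modes q"
    moreover have "real n \<le> 4 * real n * (real n + 1)"
      by (simp add: algebra_simps)
    ultimately show "n \<in> {n. real n \<le> q\<^sup>2}"
      by (simp add: upper_modes_eq)
  qed
  show "finite {n. real n \<le> q\<^sup>2}"
    by (rule finite_subset[of _ "{..nat \<lfloor>q\<^sup>2\<rfloor>}"]) (auto simp: le_nat_floor)
qed

lemma eventually_upper_mode: "\<forall>\<^sub>F q in at_infinity. n \<in> upper_modes q"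
  unfolding eventually_at_infinity
proof (intro exI allI impI)
  \<comment> \<open>The threshold works because \<open>(2n + 1)^2\<close> exceeds
    \<open>4n(n + 1)\<close> by 1.\<close>
  fix q :: real assume "2 * real n + 1 \<le> norm q"
  hence "(2 * real n + 1)\<^sup>2 \<le> q\<^sup>2"
    by (simp add: abs_le_square_iff[symmetric])
  thus "n \<in> upper_modes q"
    by (simp add: upper_modes_eq power2_eq_square algebra_simps)
qed

text \<open>For large \<open>\<bar>q\<bar>\<close> the first \<open>K\<close> modes are all in the
  upper half plane, a finite conjunction of eventual properties.\<close>

lemma card_upper_modes_at_top: "filterlim (\<lambda>q. card (upper_modes q)) at_top at_infinity"
  unfolding filterlim_at_top
proof
  fix K :: nat
  have "\<forall>\<^sub>F q in at_infinity. \<forall>n\<in>{..<K}. n \<in> upper_modes q"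
    by (intro eventually_ball_finite ballI eventually_upper_mode) auto
  thus "\<forall>\<^sub>F q in at_infinity. K \<le> card (upper_modes q)"
  proof eventually_elim
    case (elim q)
    hence "card {..<K} \<le> card (upper_modes q)"
      by (intro card_mono finite_upper_modes) auto
    thus ?case by simp
  qed
qed

theorem mainTheorem2:
  shows
    \<comment> \<open>(i) physical sheet\<close>
    "(\<forall>q::real. \<not> (\<exists>w \<in> cut_plane q. \<exists>n::nat. physical_sheet_condition q n w))
    \<and> \<comment> \<open>(ii) second sheet\<close>
    (\<forall>(q::real) (n::nat).
        {w \<in> cut_plane q. second_sheet_condition q n w} = {mode_freq q n})
    \<and> \<comment> \<open>(iii) vanishing wave number\<close>
    (mode_freq 0 0 = 0
      \<and> (\<exists>L::complex. L \<noteq> 0 \<and> (conn_coeff_C00 0 \<longlongrightarrow> L) (at 0))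
      \<and> (\<forall>n\<ge>1. Im (mode_freq 0 n) < 0))
    \<and> \<comment> \<open>(iii) nonzero wave number\<close>
    (\<forall>q::real. q \<noteq> 0 \<longrightarrow>
        mode_freq q 0 = \<i> * (of_real q)\<^sup>2 / 2 \<and> Im (mode_freq q 0) > 0)
    \<and> \<comment> \<open>(iii) migration of the modes into the upper half plane as \<open>\<bar>q\<bar>\<close> increases\<close>
    ((\<forall>(q::real) (q'::real) (n::nat).
          \<bar>q\<bar> < \<bar>q'\<bar> \<longrightarrow> Im (mode_freq q n) < Im (mode_freq q' n))
      \<and> (\<forall>(q::real) (q'::real). \<bar>q\<bar> \<le> \<bar>q'\<bar> \<longrightarrow> upper_modes q \<subseteq> upper_modes q')
      \<and> (\<forall>q::real. finite (upper_modes q))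
      \<and> (\<forall>n::nat. \<forall>\<^sub>F q::real in at_infinity. n \<in> upper_modes q)
      \<and> filterlim (\<lambda>q::real. card (upper_modes q)) at_top at_infinity)"
proof (intro conjI allI impI)
  show "\<not> (\<exists>w \<in> cut_plane q. \<exists>n. physical_sheet_condition q n w)" for q
    using no_physical_sheet_mode by blast
  show "\<exists>L. L \<noteq> 0 \<and> (conn_coeff_C00 0 \<longlongrightarrow> L) (at 0)"
    using conn_coeff_C00_tendsto by (intro exI[of _ "1 / 2"]) simp
  show "Im (mode_freq 0 n) < 0" if "1 \<le> n" for n
  proof -
    \<comment> \<open>At \<open>q = 0\<close> the numerator of \<open>Im_mode_freq\<close> is
      \<open>1 - (2n + 1)^2\<close>.\<close>
    have "(1::real)\<^sup>2 < (2 * real n + 1)\<^sup>2"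
      using that by (intro power_strict_mono) auto
    thus ?thesis
      unfolding Im_mode_freq by (intro divide_neg_pos) auto
  qed
  show "mode_freq 0 0 = 0"
    by (simp add: mode_freq_def)
  show "mode_freq q 0 = \<i> * (of_real q)\<^sup>2 / 2" for q
    by (simp add: mode_freq_def)
  show "Im (mode_freq q 0) > 0" if "q \<noteq> 0" for q
    using that by (simp add: Im_mode_freq)
qed (fact second_sheet_modes Im_mode_freq_strict_mono upper_modes_mono finite_upper_modes
  eventually_upper_mode card_upper_modes_at_top)+

end
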